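(* Let $A_0=i$, $B_0=-e^{\pi i/6}$, $C_0=e^{-\pi i/6}$ in $\mathbb{C}$, let $\mathcal{D}=\{z\in\mathbb{C}:|z|<1\}$ and let $\Gamma_0=\partial\mathcal{D}$ be the unit circle. Let $\triangle ABC$ be any triangle. \begin{enumerate} \item There is a unique point $P$ in $\mathcal{D}$ such that $\triangle(|P-A_0|,|P-B_0|,|P-C_0|)\sim\triangle ABC$. \item When $\triangle ABC$ is not equilateral, there is a unique point $P'$ in the exterior of $\mathcal{D}$ such that $\triangle(|P'-A_0|,|P'-B_0|,|P'-C_0|)\sim\triangle ABC$. \item When $\triangle ABC$ is not equilateral, the point $P'$ of (2) is the image of the point $P$ of (1) under the inversion $z\mapsto 1/\bar z$ in $\Gamma_0$. \end{enumerate}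
   Context: The plane $\mathbb{R}^2$ is identified with $\mathbb{C}$. Triangles are non-degenerate, with ordered vertices $A,B,C$ labeled anti-clockwise. Two triangles are similar, $\triangle ABC\sim\triangle A'B'C'$, if a composition of homothety, rotation and translation maps $\triangle ABC$ to $\triangle A'B'C'$ (sending $A\mapsto A'$, $B\mapsto B'$, $C\mapsto C'$); thus similarity respects the order of vertices and the orientation. For $a,b,c>0$ satisfying the three strict triangle inequalities, $\triangle(a,b,c)$ denotes any triangle $\triangle ABC$ with $|B-C|=a$, $|C-A|=b$, $|A-B|=c$ (well defined up to similarity). The assertion $\triangle(a,b,c)\sim\triangle ABC$ includes that $a,b,c$ are the side lengths of such a triangle. *)

theory Defs
  imports "HOL-Analysis.Analysis"
begin

text \<open>
  The quantity \<open>Im (cnj (B - A) * (C - A))\<close> is twice the signed area of \<open>ABC\<close>. It is positive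
  exactly when the triangle is non-degenerate and its vertices are in anti-clockwise order.
\<close>
definition is_triangle :: "complex \<Rightarrow> complex \<Rightarrow> complex \<Rightarrow> bool" where
  "is_triangle A B C \<longleftrightarrow> Im (cnj (B - A) * (C - A)) > 0"

definition equilateral :: "complex \<Rightarrow> complex \<Rightarrow> complex \<Rightarrow> bool" where
  "equilateral A B C \<longleftrightarrow> dist B C = dist C A \<and> dist C A = dist A B"

text \<open>
  A homothety of ratio \<open>r\<close> and a rotation by \<open>t\<close>, both about the origin, followed by a translation
  by \<open>w\<close>. Homotheties and rotations about other centres, and homotheties of negative ratio, only
  change \<open>w\<close> and \<open>t\<close>, so these maps are closed under composition.
\<close>
definition similarity_map :: "real \<Rightarrow> real \<Rightarrow> complex \<Rightarrow> complex \<Rightarrow> complex" where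
  "similarity_map r t w z = cis t * (complex_of_real r * z) + w"

definition similar_triangles ::
  "complex \<Rightarrow> complex \<Rightarrow> complex \<Rightarrow> complex \<Rightarrow> complex \<Rightarrow> complex \<Rightarrow> bool" where
  "similar_triangles A B C A' B' C' \<longleftrightarrow>
     (\<exists>r t w. r > 0 \<and> similarity_map r t w A = A' \<and> similarity_map r t w B = B'
        \<and> similarity_map r t w C = C')"

text \<open>
  The relation \<open>\<triangle>(a,b,c) \<sim> \<triangle>ABC\<close>. The existence of \<open>XYZ\<close> forces \<open>a\<close>, \<open>b\<close>, \<open>c\<close> to be positive and
  to satisfy the strict triangle inequalities. The choice of \<open>XYZ\<close> is immaterial, since any two
  anti-clockwise triangles with these side lengths are similar.
\<close>
definition sides_similar ::
  "real \<Rightarrow> real \<Rightarrow> real \<Rightarrow> complex \<Rightarrow> complex \<Rightarrow> complex \<Rightarrow> bool" where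
  "sides_similar a b c A B C \<longleftrightarrow>
     (\<exists>X Y Z. is_triangle X Y Z \<and> dist Y Z = a \<and> dist Z X = b \<and> dist X Y = c
        \<and> similar_triangles X Y Z A B C)"

definition A\<^sub>0 :: complex where "A\<^sub>0 = \<i>"
definition B\<^sub>0 :: complex where "B\<^sub>0 = - exp (complex_of_real pi * \<i> / 6)"
definition C\<^sub>0 :: complex where "C\<^sub>0 = exp (- (complex_of_real pi * \<i> / 6))"

definition unit_disc :: "complex set" where "unit_disc = {z. cmod z < 1}"

text \<open>
  The formula yields the junk value \<open>0\<close> at \<open>z = 0\<close>. As \<open>0\<close> is not exterior to the unit disc, the
  assertion that an exterior point is the inverse of \<open>z\<close> includes that \<open>z \<noteq> 0\<close>.
\<close>
definition circle_inversion :: "complex \<Rightarrow> complex" where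
  "circle_inversion z = 1 / cnj z"

end

theory Submission
  imports Defs
begin

text \<open>
  Write \<open>\<alpha>\<close>, \<open>\<beta>\<close>, \<open>\<gamma>\<close> for the squared sides of \<open>ABC\<close>. The squared distances from \<open>P\<close> to
  \<open>A\<^sub>0\<close>, \<open>B\<^sub>0\<close>, \<open>C\<^sub>0\<close> are \<open>\<bar>P\<bar>\<^sup>2 + 1\<close> plus linear forms in \<open>P\<close> with sum zero. Being equal to
  \<open>t\<alpha>\<close>, \<open>t\<beta>\<close>, \<open>t\<gamma>\<close> thus amounts to \<open>P = t v\<close> and \<open>\<bar>P\<bar>\<^sup>2 + 1 = t \<sigma>\<close>, where \<open>\<sigma>\<close> is the mean of
  \<open>\<alpha>\<close>, \<open>\<beta>\<close>, \<open>\<gamma>\<close> and \<open>v\<close> depends only on \<open>ABC\<close>. The points sought correspond to the roots of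
  \<open>\<bar>v\<bar>\<^sup>2 t\<^sup>2 - \<sigma> t + 1\<close>, whose discriminant is a positive multiple of the squared area. Two distinct
  roots satisfy \<open>\<bar>v\<bar>\<^sup>2 t t' = 1\<close>, so the corresponding points are inverse in the unit circle.
  The equilateral case is \<open>v = 0\<close>, when only one root remains.
\<close>

definition mean_sq_sides :: "complex \<Rightarrow> complex \<Rightarrow> complex \<Rightarrow> real" where
  "mean_sq_sides A B C = ((dist B C)\<^sup>2 + (dist C A)\<^sup>2 + (dist A B)\<^sup>2) / 3"

text \<open>The vector \<open>v\<close> of the overview. Subtracting
  \<open>\<bar>P\<bar>\<^sup>2 + 1 = t\<sigma>\<close> from the equation at \<open>A\<^sub>0\<close>
  gives 2 Im P = t (\<sigma> - \<alpha>); subtracting the equations at \<open>B\<^sub>0\<close> and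
  \<open>C\<^sub>0\<close> gives 2 sqrt 3 Re P = t (\<beta> - \<gamma>).\<close>

definition solution_direction :: "complex \<Rightarrow> complex \<Rightarrow> complex \<Rightarrow> complex" where
  "solution_direction A B C =
     Complex (sqrt 3 * ((dist C A)\<^sup>2 - (dist A B)\<^sup>2) / 6) ((mean_sq_sides A B C - (dist B C)\<^sup>2) / 2)"

lemma sides_similar_iff_proportional:
  assumes "is_triangle A B C"
  shows "sides_similar a b c A B C \<longleftrightarrow>
    (\<exists>k>0. a = k * dist B C \<and> b = k * dist C A \<and> c = k * dist A B)"
proof
  assume "sides_similar a b c A B C"
  then obtain X Y Z r t w where d: "dist Y Z = a" "dist Z X = b" "dist X Y = c" and "r > 0"
    and s: "similarity_map r t w X = A" "similarity_map r t w Y = B" "similarity_map r t w Z = C"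
    unfolding sides_similar_def similar_triangles_def by blast
  have "dist (similarity_map r t w U) (similarity_map r t w V) = r * dist U V" for U V
  proof -
    have "similarity_map r t w U - similarity_map r t w V = cis t * (complex_of_real r * (U - V))"
      by (simp add: similarity_map_def algebra_simps)
    with \<open>r > 0\<close> show ?thesis by (simp add: dist_norm norm_mult)
  qed
  with s d have "dist B C = r * a" "dist C A = r * b" "dist A B = r * c" by metis+
  with \<open>r > 0\<close> show "\<exists>k>0. a = k * dist B C \<and> b = k * dist C A \<and> c = k * dist A B"
    by (intro exI[of _ "1 / r"]) simp
next
  assume "\<exists>k>0. a = k * dist B C \<and> b = k * dist C A \<and> c = k * dist A B"
  then obtain k where k: "k > 0" "a = k * dist B C" "b = k * dist C A" "c = k * dist A B" by blast
  \<comment> \<open>The witness is \<open>ABC\<close> scaled by \<open>k\<close> about the origin.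
    Its signed area is multiplied by \<open>k\<^sup>2\<close>, so it stays anti-clockwise, and ratio
    \<open>1 / k\<close> with angle 0 leads back to \<open>ABC\<close>.\<close>
  define X Y Z where XYZ: "X = complex_of_real k * A" "Y = complex_of_real k * B"
    "Z = complex_of_real k * C"
  have "Im (cnj (Y - X) * (Z - X)) = k\<^sup>2 * Im (cnj (B - A) * (C - A))"
    by (simp add: XYZ power2_eq_square algebra_simps)
  with assms k have "is_triangle X Y Z" by (simp add: is_triangle_def)
  moreover have "dist (complex_of_real k * U) (complex_of_real k * V) = k * dist U V" for U V
    using k(1) by (simp add: dist_norm norm_mult flip: right_diff_distrib)
  moreover have "similar_triangles X Y Z A B C"
    unfolding similar_triangles_def similarity_map_def using k(1)
    by (intro exI[of _ "1 / k"] exI[of _ 0]) (simp add: XYZ)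
  ultimately show "sides_similar a b c A B C"
    unfolding sides_similar_def using k XYZ by metis
qed

lemma B\<^sub>0_eq: "B\<^sub>0 = Complex (- (sqrt 3 / 2)) (- (1 / 2))"
proof -
  have "exp (complex_of_real pi * \<i> / 6) = cis (pi / 6)"
    by (simp add: cis_conv_exp mult.commute)
  then show ?thesis by (simp add: B\<^sub>0_def complex_eq_iff cos_30 sin_30)
qed

lemma C\<^sub>0_eq: "C\<^sub>0 = Complex (sqrt 3 / 2) (- (1 / 2))"
proof -
  have "exp (- (complex_of_real pi * \<i> / 6)) = cis (- (pi / 6))"
    by (simp add: cis_conv_exp mult.commute)
  then show ?thesis by (simp add: C\<^sub>0_def complex_eq_iff cos_30 sin_30)
qed

lemma cmod_diff_A\<^sub>0: "(cmod (P - A\<^sub>0))\<^sup>2 = (cmod P)\<^sup>2 + 1 - 2 * Im P"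
  unfolding A\<^sub>0_def cmod_power2 by (simp add: power2_eq_square algebra_simps)

lemma cmod_diff_B\<^sub>0: "(cmod (P - B\<^sub>0))\<^sup>2 = (cmod P)\<^sup>2 + 1 + sqrt 3 * Re P + Im P"
  unfolding B\<^sub>0_eq cmod_power2 by (simp add: power2_eq_square field_simps)

lemma cmod_diff_C\<^sub>0: "(cmod (P - C\<^sub>0))\<^sup>2 = (cmod P)\<^sup>2 + 1 - sqrt 3 * Re P + Im P"
  unfolding C\<^sub>0_eq cmod_power2 by (simp add: power2_eq_square field_simps)

lemma sq_distances_proportional_iff:
  "(cmod (P - A\<^sub>0))\<^sup>2 = t * (dist B C)\<^sup>2 \<and> (cmod (P - B\<^sub>0))\<^sup>2 = t * (dist C A)\<^sup>2 \<and>
   (cmod (P - C\<^sub>0))\<^sup>2 = t * (dist A B)\<^sup>2 \<longleftrightarrow>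
   P = of_real t * solution_direction A B C \<and> (cmod P)\<^sup>2 + 1 = t * mean_sq_sides A B C"
proof -
  define \<alpha> \<beta> \<gamma> x where "\<alpha> = t * (dist B C)\<^sup>2" "\<beta> = t * (dist C A)\<^sup>2" "\<gamma> = t * (dist A B)\<^sup>2"
    "x = sqrt 3 * Re P"
  note defs = this
  \<comment> \<open>Multiplying by \<open>sqrt 3\<close> removes the root from the right-hand side,
    so that all conditions become linear in \<open>x\<close>, \<open>Im P\<close>,
    \<open>(cmod P)\<^sup>2\<close>, \<alpha>, \<beta>, \<gamma> with rational coefficients.\<close>
  have "Re P = t * (sqrt 3 * ((dist C A)\<^sup>2 - (dist A B)\<^sup>2) / 6) \<longleftrightarrow>
      sqrt 3 * Re P = sqrt 3 * (t * (sqrt 3 * ((dist C A)\<^sup>2 - (dist A B)\<^sup>2) / 6))"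
    by simp
  also have "sqrt 3 * (t * (sqrt 3 * ((dist C A)\<^sup>2 - (dist A B)\<^sup>2) / 6)) =
      (sqrt 3 * sqrt 3) * (\<beta> - \<gamma>) / 6"
    by (simp only: defs) algebra
  also have "\<dots> = (\<beta> - \<gamma>) / 2"
    by simp
  finally have re: "Re P = Re (of_real t * solution_direction A B C) \<longleftrightarrow> x = (\<beta> - \<gamma>) / 2"
    by (simp add: solution_direction_def defs)
  have mean: "t * mean_sq_sides A B C = (\<alpha> + \<beta> + \<gamma>) / 3"
    by (simp add: mean_sq_sides_def defs field_simps)
  then have im: "Im (of_real t * solution_direction A B C) = ((\<alpha> + \<beta> + \<gamma>) / 3 - \<alpha>) / 2"
    by (simp add: solution_direction_def defs field_simps)
  show ?thesis
    unfolding cmod_diff_A\<^sub>0 cmod_diff_B\<^sub>0 cmod_diff_C\<^sub>0 complex_eq_iff[of P] re im mean defs[symmetric]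
    by argo
qed

lemma sides_similar_iff:
  assumes "is_triangle A B C"
  shows "sides_similar (cmod (P - A\<^sub>0)) (cmod (P - B\<^sub>0)) (cmod (P - C\<^sub>0)) A B C \<longleftrightarrow>
    (\<exists>t>0. P = of_real t * solution_direction A B C \<and> (cmod P)\<^sup>2 + 1 = t * mean_sq_sides A B C)"
proof -
  have sq: "u = k * d \<longleftrightarrow> u\<^sup>2 = k\<^sup>2 * d\<^sup>2" if "u \<ge> 0" "d \<ge> 0" "k > 0" for u d k :: real
    using that power2_eq_iff_nonneg[of u "k * d"] by (simp add: power_mult_distrib)
  \<comment> \<open>Every positive real is the square of a positive real, so the ratio
    \<open>k\<close> of the sides can be traded for the ratio \<open>t\<close> of their
    squares.\<close>
  have squares: "(\<exists>k>0. Q (k\<^sup>2)) \<longleftrightarrow> (\<exists>t>0. Q t)" for Q :: "real \<Rightarrow> bool"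
    by (metis real_sqrt_gt_zero real_sqrt_pow2 less_imp_le zero_less_power)
  have "sides_similar (cmod (P - A\<^sub>0)) (cmod (P - B\<^sub>0)) (cmod (P - C\<^sub>0)) A B C \<longleftrightarrow>
    (\<exists>k>0. (cmod (P - A\<^sub>0))\<^sup>2 = k\<^sup>2 * (dist B C)\<^sup>2 \<and> (cmod (P - B\<^sub>0))\<^sup>2 = k\<^sup>2 * (dist C A)\<^sup>2 \<and>
       (cmod (P - C\<^sub>0))\<^sup>2 = k\<^sup>2 * (dist A B)\<^sup>2)"
    unfolding sides_similar_iff_proportional[OF assms] using sq by (metis norm_ge_zero zero_le_dist)
  then show ?thesis
    unfolding sq_distances_proportional_iff
    using squares[of "\<lambda>t. P = of_real t * solution_direction A B C \<and>
      (cmod P)\<^sup>2 + 1 = t * mean_sq_sides A B C"] by simp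
qed

text \<open>A form of Heron's formula: once \<open>sqrt 3\<close> is squared away, it is a
  polynomial identity in the coordinates of the vertices. Non-degeneracy thus makes the discriminant
  strictly positive.\<close>

lemma mean_sq_sides_discriminant:
  "(mean_sq_sides A B C)\<^sup>2 =
     4 * (cmod (solution_direction A B C))\<^sup>2 + 4 / 3 * (Im (cnj (B - A) * (C - A)))\<^sup>2"
proof -
  have "3 * ((dist C A)\<^sup>2 - (dist A B)\<^sup>2)\<^sup>2 = (sqrt 3 * ((dist C A)\<^sup>2 - (dist A B)\<^sup>2))\<^sup>2"
    by (simp add: power_mult_distrib)
  then have "(cmod (solution_direction A B C))\<^sup>2 =
      ((dist C A)\<^sup>2 - (dist A B)\<^sup>2)\<^sup>2 / 12 + (mean_sq_sides A B C - (dist B C)\<^sup>2)\<^sup>2 / 4"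
    by (simp add: solution_direction_def cmod_power2 power_divide)
  then show ?thesis
    unfolding mean_sq_sides_def dist_norm cmod_power2
    by (simp add: power2_eq_square field_simps)
qed

lemma mean_sq_sides_pos:
  assumes "is_triangle A B C"
  shows "mean_sq_sides A B C > 0"
proof -
  have "B \<noteq> A" using assms by (auto simp: is_triangle_def)
  then have "(dist A B)\<^sup>2 > 0" by simp
  then show ?thesis unfolding mean_sq_sides_def by (simp add: add_nonneg_pos)
qed

lemma solution_direction_eq_0_iff: "solution_direction A B C = 0 \<longleftrightarrow> equilateral A B C"
proof -
  have "solution_direction A B C = 0 \<longleftrightarrow>
      (dist B C)\<^sup>2 = (dist C A)\<^sup>2 \<and> (dist C A)\<^sup>2 = (dist A B)\<^sup>2"
    by (auto simp: solution_direction_def mean_sq_sides_def complex_eq_iff)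
  then show ?thesis by (simp add: equilateral_def)
qed

lemma quadratic_root_inside:
  fixes q s :: real
  assumes "q \<ge> 0" "s > 0" "4 * q < s\<^sup>2"
  obtains t where "t > 0" "q * t\<^sup>2 + 1 = t * s" "q * t\<^sup>2 < 1"
proof
  define d where "d = sqrt (s\<^sup>2 - 4 * q)"
  have d: "d > 0" "d\<^sup>2 = s\<^sup>2 - 4 * q" using assms by (simp_all add: d_def)
  \<comment> \<open>This is the smaller root (s - d) / (2q), rationalised so that it also makes
    sense for \<open>q = 0\<close>, the equilateral case.\<close>
  let ?t = "2 / (s + d)"
  show "?t > 0" using d assms by simp
  have "4 * q + (s + d)\<^sup>2 = 2 * s * (s + d)"
    using d(2) by (simp add: power2_eq_square algebra_simps)
  then show "q * ?t\<^sup>2 + 1 = ?t * s"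
    using d(1) assms(2) by (simp add: power_divide power2_eq_square divide_simps)
  have "s\<^sup>2 < (s + d)\<^sup>2" using d(1) assms(2) by (intro power_strict_mono) auto
  with assms(3) have "4 * q < (s + d)\<^sup>2" by simp
  then show "q * ?t\<^sup>2 < 1" using d(1) assms(2) by (simp add: power_divide divide_simps)
qed

text \<open>Vieta's formula for the product of the roots. Cross-multiplying the two equations
  eliminates \<open>s\<close> and avoids dividing by \<open>q\<close>.\<close>

lemma quadratic_roots_product:
  fixes q s t u :: real
  assumes "q * t\<^sup>2 + 1 = t * s" "q * u\<^sup>2 + 1 = u * s" "t \<noteq> u"
  shows "q * t * u = 1"
proof -
  have "(t - u) * (q * t * u - 1) = u * (q * t\<^sup>2 + 1) - t * (q * u\<^sup>2 + 1)"
    by (simp add: power2_eq_square algebra_simps)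
  also have "\<dots> = 0" by (simp add: assms)
  finally show ?thesis using assms(3) by simp
qed

theorem theorem2:
  fixes A B C :: complex
  assumes "is_triangle A B C"
  shows "(\<exists>!P. P \<in> unit_disc \<and>
            sides_similar (cmod (P - A\<^sub>0)) (cmod (P - B\<^sub>0)) (cmod (P - C\<^sub>0)) A B C)
    \<and> (\<not> equilateral A B C \<longrightarrow>
        (\<exists>!P'. P' \<in> - closure unit_disc \<and>
            sides_similar (cmod (P' - A\<^sub>0)) (cmod (P' - B\<^sub>0)) (cmod (P' - C\<^sub>0)) A B C))
    \<and> (\<not> equilateral A B C \<longrightarrow>
        (\<forall>P P'. P \<in> unit_disc \<longrightarrow>
            sides_similar (cmod (P - A\<^sub>0)) (cmod (P - B\<^sub>0)) (cmod (P - C\<^sub>0)) A B C \<longrightarrow>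
            P' \<in> - closure unit_disc \<longrightarrow>
            sides_similar (cmod (P' - A\<^sub>0)) (cmod (P' - B\<^sub>0)) (cmod (P' - C\<^sub>0)) A B C \<longrightarrow>
            P' = circle_inversion P))"
proof -
  define v s q where "v = solution_direction A B C" "s = mean_sq_sides A B C" "q = (cmod v)\<^sup>2"
  note defs = this
  let ?S = "\<lambda>P. sides_similar (cmod (P - A\<^sub>0)) (cmod (P - B\<^sub>0)) (cmod (P - C\<^sub>0)) A B C"
  let ?root = "\<lambda>t. t > 0 \<and> q * t\<^sup>2 + 1 = t * s"
  have sq_cmod: "(cmod (of_real t * v))\<^sup>2 = q * t\<^sup>2" for t
    by (simp add: defs norm_mult power_mult_distrib)
  have S_iff: "?S P \<longleftrightarrow> (\<exists>t. P = of_real t * v \<and> ?root t)" for P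
    unfolding sides_similar_iff[OF assms] using sq_cmod by (auto simp flip: defs)
  have inside_iff: "of_real t * v \<in> unit_disc \<longleftrightarrow> q * t\<^sup>2 < 1" for t
    unfolding unit_disc_def by (simp add: abs_square_less_1 flip: sq_cmod)
  have "closure unit_disc = cball 0 1"
    using closure_ball[of 1 "0::complex"] by (simp add: unit_disc_def ball_def)
  then have "of_real t * v \<in> - closure unit_disc \<longleftrightarrow> \<not> (cmod (of_real t * v))\<^sup>2 \<le> 1" for t
    using abs_square_le_1[of "cmod (of_real t * v)"] by simp
  then have outside_iff: "of_real t * v \<in> - closure unit_disc \<longleftrightarrow> q * t\<^sup>2 > 1" for t
    by (simp only: sq_cmod not_le)
  have inside: "P \<in> unit_disc \<and> ?S P \<longleftrightarrow> (\<exists>t. P = of_real t * v \<and> ?root t \<and> q * t\<^sup>2 < 1)" for P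
    unfolding S_iff using inside_iff by auto
  have outside:
    "P \<in> - closure unit_disc \<and> ?S P \<longleftrightarrow> (\<exists>t. P = of_real t * v \<and> ?root t \<and> q * t\<^sup>2 > 1)" for P
    unfolding S_iff using outside_iff by blast
  have "q \<ge> 0" by (simp add: defs)
  \<comment> \<open>As \<open>q * t\<^sup>2\<close> is the squared modulus of the point with
    parameter \<open>t\<close>, two distinct roots cannot both give points inside the circle, nor
    both outside. Both uniqueness claims rest on this.\<close>
  have product: "(q * t\<^sup>2) * (q * u\<^sup>2) = 1" if "?root t" "?root u" "t \<noteq> u" for t u
  proof -
    have "(q * t\<^sup>2) * (q * u\<^sup>2) = (q * t * u)\<^sup>2" by (simp add: power_mult_distrib power2_eq_square)
    also have "q * t * u = 1" using that quadratic_roots_product by blast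
    finally show ?thesis by simp
  qed
  have "Im (cnj (B - A) * (C - A)) > 0" using assms by (simp only: is_triangle_def)
  then have "4 * q < s\<^sup>2"
    unfolding defs mean_sq_sides_discriminant[of A B C] by simp
  moreover have "s > 0" unfolding defs by (rule mean_sq_sides_pos[OF assms])
  ultimately obtain t where t: "?root t" "q * t\<^sup>2 < 1"
    using quadratic_root_inside \<open>q \<ge> 0\<close> by blast

  have "\<exists>!P. P \<in> unit_disc \<and> ?S P"
  proof (rule ex1I)
    show "of_real t * v \<in> unit_disc \<and> ?S (of_real t * v)"
      unfolding inside using t by blast
  next
    fix P assume "P \<in> unit_disc \<and> ?S P"
    then obtain u where u: "P = of_real u * v" "?root u" "q * u\<^sup>2 < 1"
      using inside[of P] by blast
    have "(q * t\<^sup>2) * (q * u\<^sup>2) < 1"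
      using mult_strict_mono'[OF t(2) u(3)] \<open>q \<ge> 0\<close> by simp
    then have "u = t" using product[OF t(1) u(2)] by auto
    with u show "P = of_real t * v" by simp
  qed
  moreover have "\<exists>!P. P \<in> - closure unit_disc \<and> ?S P" if "\<not> equilateral A B C"
  proof -
    have "q > 0" using that solution_direction_eq_0_iff[of A B C] by (simp add: defs)
    \<comment> \<open>The second root, as predicted by Vieta. Its point has squared modulus
      \<open>1 / (q * t\<^sup>2)\<close>, hence lies outside.\<close>
    define u where "u = 1 / (q * t)"
    have "q * u\<^sup>2 = 1 / (q * t\<^sup>2)"
      using \<open>q > 0\<close> t(1) by (simp add: u_def power2_eq_square field_simps)
    moreover from this have "q * u\<^sup>2 + 1 = (q * t\<^sup>2 + 1) / (q * t\<^sup>2)"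
      using \<open>q > 0\<close> t(1) by (simp add: field_simps)
    moreover have "t * s / (q * t\<^sup>2) = u * s"
      using \<open>q > 0\<close> t(1) by (simp add: u_def power2_eq_square)
    ultimately have u: "?root u" "q * u\<^sup>2 > 1"
      using \<open>q > 0\<close> t by (simp_all add: u_def)
    show ?thesis
    proof (rule ex1I)
      show "of_real u * v \<in> - closure unit_disc \<and> ?S (of_real u * v)"
        unfolding outside using u by blast
    next
      fix P assume "P \<in> - closure unit_disc \<and> ?S P"
      then obtain w where w: "P = of_real w * v" "?root w" "q * w\<^sup>2 > 1"
        using outside[of P] by blast
      have "(q * u\<^sup>2) * (q * w\<^sup>2) > 1"
        using less_1_mult u(2) w(3) by blast
      then have "w = u" using product[OF u(1) w(2)] by auto
      with w show "P = of_real u * v" by simp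
    qed
  qed
  moreover have "P' = circle_inversion P"
    if "P \<in> unit_disc" "?S P" "P' \<in> - closure unit_disc" "?S P'" for P P'
  proof -
    from that(1,2) obtain w where w: "P = of_real w * v" "?root w" "q * w\<^sup>2 < 1"
      using inside[of P] by blast
    from that(3,4) obtain u where u: "P' = of_real u * v" "?root u" "q * u\<^sup>2 > 1"
      using outside[of P'] by blast
    \<comment> \<open>The roots differ because
      \<open>q * w\<^sup>2 < 1 < q * u\<^sup>2\<close>.\<close>
    have "q * w * u = 1" using quadratic_roots_product[of q w s u] w u by fastforce
    then have "of_real q * of_real w * of_real u = (1 :: complex)"
      by (metis of_real_1 of_real_mult)
    moreover have "v * cnj v = of_real q"
      by (simp only: defs complex_norm_square)
    moreover have "P' * cnj P = (v * cnj v) * of_real w * of_real u"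
      by (simp add: w(1) u(1))
    ultimately have "P' * cnj P = 1" by simp
    \<comment> \<open>The product being 1 also forces \<open>P\<close> to be nonzero, so the
      inversion is not taken at its junk value.\<close>
    then show ?thesis unfolding circle_inversion_def by (metis mult_zero_right nonzero_eq_divide_eq zero_neq_one)
  qed
  ultimately show ?thesis by blast
qed

end
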